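(* Let $i\in\{1,2,3\}$ and $f\in\mathcal{S}^*(\phi_i)$. Then $f\in G_{\frac12,\frac12}$ in the disk $|z|<r_i$, i.e. $$\left|\frac{\frac12+\frac12 zf''(z)/f'(z)}{zf'(z)/f(z)}-\frac12\right|<\frac12\qquad\text{for all }|z|<r_i,$$ in the following cases: (i) $\phi_1(z)=e^z$ and $r_1\approx0.537561$ is the smallest positive root of $e^r(1+r^2)^2-4(1-r^2)=0$; (ii) $\phi_2(z)=\sqrt{1+z}$ and $r_2\approx0.429874$ is the smallest positive root of $(1+r^2)^2-4(1-r)^{3/2}(1-r^2)=0$; (iii) $\phi_3(z)=2/(1+e^{-z})$ and $r_3\approx0.683447$ is the smallest positive root of $e^r(1+r^2)^2-8(1-r^2)=0$.
   Context: $\mathbb{D}=\{z\in\mathbb{C}:|z|<1\}$. $\mathcal{A}$ is the class of analytic functions $f$ on $\mathbb{D}$ with $f(0)=0$, $f'(0)=1$. For $0<\alpha\le1$ and $\lambda>0$, $$G_{\lambda,\alpha}=\left\{f\in\mathcal{A}:\left|\frac{1-\alpha+\alpha zf''(z)/f'(z)}{zf'(z)/f(z)}-(1-\alpha)\right|<\lambda,\ z\in\mathbb{D}\right\};$$ "$f\in G_{\lambda,\alpha}$ in the disk $|z|<r$" means that the defining inequality holds for all $|z|<r$. Expressions such as $zf'(z)/f(z)$ are given their limiting values at $z=0$. $\mathcal{S}^*(\phi)$ is the class of $f\in\mathcal{A}$ with $zf'(z)/f(z)\prec\phi(z)$, where $p\prec\phi$ means $p=\phi\circ\omega$ for some analytic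 $\omega:\mathbb{D}\to\mathbb{D}$ with $\omega(0)=0$. The square root is the principal branch. *)

theory Defs
  imports "HOL-Analysis.Analysis"
begin

abbreviation unit_disk :: "complex set" ("\<D>") where
  "\<D> \<equiv> ball 0 1"

definition class_A :: "(complex \<Rightarrow> complex) set" ("\<A>") where
  "\<A> = {f. f holomorphic_on \<D> \<and> f 0 = 0 \<and> deriv f 0 = 1}"

text \<open>
  The quotient \<open>z f'(z) / f(z)\<close>, with its limiting value at \<open>z = 0\<close>, where the formula
  itself reads \<open>0 / 0\<close>.
\<close>
definition starlike_quotient :: "(complex \<Rightarrow> complex) \<Rightarrow> complex \<Rightarrow> complex" where
  "starlike_quotient f z =
     (if z = 0 then Lim (at 0) (\<lambda>w. w * deriv f w / f w) else z * deriv f z / f z)"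

definition subordinate :: "(complex \<Rightarrow> complex) \<Rightarrow> (complex \<Rightarrow> complex) \<Rightarrow> bool" (infix "\<prec>\<^sub>D" 50) where
  "p \<prec>\<^sub>D \<phi> \<longleftrightarrow>
     (\<exists>\<omega>. \<omega> holomorphic_on \<D> \<and> \<omega> ` \<D> \<subseteq> \<D> \<and> \<omega> 0 = 0 \<and> (\<forall>z\<in>\<D>. p z = \<phi> (\<omega> z)))"

text \<open>
  In the next two definitions the conditions \<open>f z \<noteq> 0\<close> and \<open>deriv f z \<noteq> 0\<close> say that the quotients
  involved are defined at \<open>z\<close>; they are needed because HOL sets \<open>x / 0 = 0\<close>.
\<close>
definition S_star :: "(complex \<Rightarrow> complex) \<Rightarrow> (complex \<Rightarrow> complex) set" where
  "S_star \<phi> = {f \<in> \<A>. (\<forall>z\<in>\<D> - {0}. f z \<noteq> 0) \<and> starlike_quotient f \<prec>\<^sub>D \<phi>}"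

text \<open>
  The functions that belong to \<open>G\<^bsub>lam,\<alpha>\<^esub>\<close> in the disk \<open>|z| < r\<close>, for \<open>r \<le> 1\<close>; the class
  \<open>G\<^bsub>lam,\<alpha>\<^esub>\<close> itself is the case \<open>r = 1\<close>.
\<close>
definition G_disk :: "real \<Rightarrow> real \<Rightarrow> real \<Rightarrow> (complex \<Rightarrow> complex) set" where
  "G_disk lam \<alpha> r = {f \<in> \<A>. \<forall>z. norm z < r \<longrightarrow>
     (z \<noteq> 0 \<longrightarrow> f z \<noteq> 0) \<and> deriv f z \<noteq> 0 \<and>
     norm ((1 - of_real \<alpha> + of_real \<alpha> * (z * deriv (deriv f) z / deriv f z)) / starlike_quotient f z
           - (1 - of_real \<alpha>)) < lam}"

definition smallest_positive_root :: "(real \<Rightarrow> real) \<Rightarrow> real \<Rightarrow> bool" where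
  "smallest_positive_root F r \<longleftrightarrow> 0 < r \<and> F r = 0 \<and> (\<forall>s. 0 < s \<and> s < r \<longrightarrow> F s \<noteq> 0)"

end

theory Submission
  imports Defs "HOL-Complex_Analysis.Riemann_Mapping"
begin

text \<open>
  Put \<open>p = z f'/f = \<phi> \<circ> \<omega>\<close>. Since \<open>1 + z f''/f' = p + z p'/p\<close>, the quantity to be bounded is
  \<open>z p'/(2 p\<^sup>2)\<close>, so the claim becomes \<open>|\<phi>'(\<omega>)/\<phi>(\<omega>)\<^sup>2| |z \<omega>'| < 1\<close>. Writing \<open>\<omega> = z h\<close> and applying
  Schwarz-Pick to \<open>h\<close> gives \<open>|z \<omega>'| \<le> r t + r\<^sup>2 (1 - t\<^sup>2)/(1 - r\<^sup>2)\<close> with \<open>r = |z|\<close> and \<open>t = |h(z)|\<close>;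
  maximising over \<open>t\<close> yields \<open>|z \<omega>'| \<le> (1 + r\<^sup>2)\<^sup>2/(4 (1 - r\<^sup>2))\<close>. The other factor is at most
  \<open>e\<^sup>r\<close>, \<open>1/(2 (1 - r)\<^bsup>3/2\<^esup>)\<close> and \<open>e\<^sup>r/2\<close> respectively, because \<open>|\<omega>| \<le> r\<close>. In the second case
  the equation in the statement asks for twice what is needed.
\<close>

section \<open>Schwarz-Pick and Dieudonne estimates\<close>

lemma one_minus_cnj_mult_nonzero:
  fixes b z :: complex
  assumes "norm b < 1" "norm z < 1"
  shows "1 - cnj b * z \<noteq> 0"
proof
  assume "1 - cnj b * z = 0"
  then have "norm (cnj b * z) = 1" by (metis norm_one right_minus_eq)
  moreover have "norm (cnj b * z) < 1"
    using assms norm_mult_less[of "cnj b" 1 z 1] by simp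
  ultimately show False by simp
qed

lemma Moebius_function_has_field_derivative:
  assumes "norm b < 1" "norm z < 1"
  shows "(Moebius_function 0 b has_field_derivative (1 - b * cnj b) / (1 - cnj b * z)\<^sup>2) (at z)"
  unfolding Moebius_function_simple[abs_def]
  using one_minus_cnj_mult_nonzero[OF assms]
  by (auto intro!: derivative_eq_intros simp: power2_eq_square divide_simps algebra_simps)

text \<open>Composing \<open>g\<close> on both sides with disk automorphisms, one sending 0 to
  \<open>a\<close> and one sending \<open>g a\<close> to 0, gives a self-map \<open>F\<close> of the
  disk fixing 0. Schwarz's lemma bounds its derivative at 0, and the chain rule turns that into the
  estimate at \<open>a\<close>.\<close>

lemma Schwarz_Pick_deriv:
  assumes holg: "g holomorphic_on ball 0 1"
    and g1: "\<And>z. norm z < 1 \<Longrightarrow> norm (g z) < 1"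
    and a: "norm a < 1"
  shows "norm (deriv g a) * (1 - (norm a)\<^sup>2) \<le> 1 - (norm (g a))\<^sup>2"
proof -
  define F where "F = Moebius_function 0 (g a) \<circ> (g \<circ> Moebius_function 0 (- a))"
  have b: "norm (g a) < 1" and a': "norm (- a) < 1" using a g1 by auto
  have M0: "Moebius_function 0 (- a) 0 = a" by (simp add: Moebius_function_of_zero)
  have Fhol: "F holomorphic_on ball 0 1"
    unfolding F_def
    by (intro holomorphic_on_compose_gen[where t = "ball 0 1"] Moebius_function_holomorphic a' b holg)
       (use a in \<open>auto intro!: Moebius_function_norm_lt_1 g1\<close>)
  have F0: "F 0 = 0" by (simp add: F_def M0 Moebius_function_eq_zero)
  have F1: "norm (F z) < 1" if "norm z < 1" for z
    unfolding F_def using that a b by (auto intro!: Moebius_function_norm_lt_1 g1)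
  have dg: "(g has_field_derivative deriv g a) (at (Moebius_function 0 (- a) 0))"
    using holomorphic_derivI[OF holg open_ball] a by (simp add: M0)
  have dM: "(Moebius_function 0 (- a) has_field_derivative (1 - a * cnj a)) (at 0)"
    using Moebius_function_has_field_derivative[OF a', of 0] by simp
  have dMb: "(Moebius_function 0 (g a) has_field_derivative
      (1 - g a * cnj (g a)) / (1 - cnj (g a) * g a)\<^sup>2) (at ((g \<circ> Moebius_function 0 (- a)) 0))"
    using Moebius_function_has_field_derivative[OF b b] by (simp add: M0)
  have "deriv F 0 = (1 - g a * cnj (g a)) / (1 - cnj (g a) * g a)\<^sup>2
      * (deriv g a * (1 - a * cnj a))"
    unfolding F_def by (intro DERIV_imp_deriv DERIV_chain dMb dg dM)
  \<comment> \<open>The numerator 1 - |g a|^2 cancels one of the two equal factors in the squared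
    denominator.\<close>
  also have "\<dots> = deriv g a * (1 - a * cnj a) / (1 - cnj (g a) * g a)"
    using one_minus_cnj_mult_nonzero[OF b b] by (simp add: power2_eq_square mult.commute)
  also have "\<dots> = deriv g a * of_real (1 - (norm a)\<^sup>2) / of_real (1 - (norm (g a))\<^sup>2)"
    by (simp only: mult.commute[of "cnj (g a)"] complex_norm_square[symmetric] of_real_diff of_real_1)
  finally have "norm (deriv F 0)
      = norm (deriv g a) * \<bar>1 - (norm a)\<^sup>2\<bar> / \<bar>1 - (norm (g a))\<^sup>2\<bar>"
    by (simp only: norm_mult norm_divide norm_of_real)
  moreover have "norm (deriv F 0) \<le> 1"
    using Schwarz_Lemma(2)[OF Fhol F0 F1, of 0] by simp
  moreover have "(norm a)\<^sup>2 < 1" "(norm (g a))\<^sup>2 < 1" using a b by (auto simp: abs_square_less_1)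
  ultimately show ?thesis
    using mult_right_mono[of "norm (deriv F 0)" 1 "1 - (norm (g a))\<^sup>2"] by (simp add: divide_simps)
qed

text \<open>With \<omega> = z h, Schwarz-Pick applies when \<open>h\<close> maps the disk into the
  open disk. Otherwise the equality case of Schwarz's lemma makes \<omega> a rotation, and the
  estimate is checked directly.\<close>

lemma Dieudonne_bound:
  assumes hol: "\<omega> holomorphic_on ball 0 1" and \<omega>0: "\<omega> 0 = 0"
    and \<omega>1: "\<And>z. norm z < 1 \<Longrightarrow> norm (\<omega> z) < 1"
    and z: "norm z < 1"
  shows "norm (z * deriv \<omega> z) * (4 * (1 - (norm z)\<^sup>2)) \<le> (1 + (norm z)\<^sup>2)\<^sup>2"
proof -
  define r where "r = norm z"
  have r: "0 \<le> r" "r < 1" "r\<^sup>2 < 1" using z by (auto simp: r_def abs_square_less_1)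
  have zb: "z \<in> ball 0 1" using z by simp
  obtain h where h: "h holomorphic_on ball 0 1" "\<And>z. norm z < 1 \<Longrightarrow> \<omega> z = z * h z"
      "deriv \<omega> 0 = h 0"
    using Schwarz3[OF hol \<omega>0] by metis
  show ?thesis
  proof (cases "\<forall>w. norm w < 1 \<longrightarrow> norm (h w) < 1")
    case True
    define t where "t = norm (h z)"
    have dh: "(h has_field_derivative deriv h z) (at z)"
      using holomorphic_derivI[OF h(1) open_ball zb] .
    have "((\<lambda>w. w * h w) has_field_derivative (h z + z * deriv h z)) (at z)"
      using DERIV_mult[OF DERIV_ident dh] by (simp add: algebra_simps)
    then have "(\<omega> has_field_derivative (h z + z * deriv h z)) (at z)"
      by (rule has_field_derivative_transform_within_open[OF _ open_ball zb]) (simp add: h(2))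
    then have "norm (z * deriv \<omega> z) = norm (z * h z + z * z * deriv h z)"
      by (simp add: DERIV_imp_deriv algebra_simps)
    also have "\<dots> \<le> r * t + r\<^sup>2 * norm (deriv h z)"
      by (rule order_trans[OF norm_triangle_ineq]) (simp add: norm_mult r_def t_def power2_eq_square)
    finally have "norm (z * deriv \<omega> z) * (4 * (1 - r\<^sup>2))
        \<le> (r * t + r\<^sup>2 * norm (deriv h z)) * (4 * (1 - r\<^sup>2))"
      using r by (intro mult_right_mono) auto
    also have "\<dots> = 4 * r * t * (1 - r\<^sup>2) + 4 * r\<^sup>2 * (norm (deriv h z) * (1 - r\<^sup>2))"
      by (simp add: algebra_simps)
    also have "\<dots> \<le> 4 * r * t * (1 - r\<^sup>2) + 4 * r\<^sup>2 * (1 - t\<^sup>2)"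
      using Schwarz_Pick_deriv[OF h(1) _ z] True
      by (intro add_left_mono mult_left_mono) (auto simp: r_def t_def)
    also have "\<dots> \<le> (1 + r\<^sup>2)\<^sup>2"
    proof -
      \<comment> \<open>The gap is a perfect square for every real t; for r > 0 it vanishes at t =
        (1 - r^2) / (2 r), the maximiser of the preceding bound.\<close>
      have "(1 + r\<^sup>2)\<^sup>2 - (4 * r * t * (1 - r\<^sup>2) + 4 * r\<^sup>2 * (1 - t\<^sup>2)) = (1 - r\<^sup>2 - 2 * r * t)\<^sup>2"
        by (simp add: power2_eq_square algebra_simps)
      then show ?thesis using zero_le_power2[of "1 - r\<^sup>2 - 2 * r * t"] by linarith
    qed
    finally show ?thesis by (simp add: r_def)
  next
    case False
    then obtain w where w: "norm w < 1" "norm (h w) \<ge> 1" by (auto simp: not_less)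
    \<comment> \<open>A point with |h w| \<ge> 1 is an equality case of Schwarz's lemma: at w = 0
      because \<open>h 0\<close> is the derivative of \<omega> there, elsewhere because |\<omega> w|
      = |w| |h w| is also at most |w|.\<close>
    have "\<exists>\<alpha>. (\<forall>z. norm z < 1 \<longrightarrow> \<omega> z = \<alpha> * z) \<and> norm \<alpha> = 1"
    proof (rule Schwarz_Lemma(3)[OF hol \<omega>0 \<omega>1 z])
      show "(\<exists>z. norm z < 1 \<and> z \<noteq> 0 \<and> norm (\<omega> z) = norm z) \<or> norm (deriv \<omega> 0) = 1"
      proof (cases "w = 0")
        case True
        then show ?thesis
          using Schwarz_Lemma(2)[OF hol \<omega>0 \<omega>1 z] w h(3) by simp
      next
        case False
        have "norm w * norm (h w) \<le> norm w"
          using Schwarz_Lemma(1)[OF hol \<omega>0 \<omega>1 w(1)] w h(2) by (simp add: norm_mult)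
        then have "norm (\<omega> w) = norm w"
          using w h(2) False mult_left_mono[of 1 "norm (h w)" "norm w"] by (simp add: norm_mult)
        then show ?thesis using w False by blast
      qed
    qed
    then obtain \<alpha> where \<alpha>: "\<And>z. norm z < 1 \<Longrightarrow> \<omega> z = \<alpha> * z" "norm \<alpha> = 1" by blast
    have "((\<lambda>w. \<alpha> * w) has_field_derivative \<alpha>) (at z)"
      by (auto intro!: derivative_eq_intros)
    then have "(\<omega> has_field_derivative \<alpha>) (at z)"
      by (rule has_field_derivative_transform_within_open[OF _ open_ball zb]) (simp add: \<alpha>(1))
    then have "norm (z * deriv \<omega> z) = r"
      by (simp add: DERIV_imp_deriv norm_mult \<alpha> r_def)
    \<comment> \<open>The same square as in the first case, taken at t = 1.\<close>
    moreover have "(1 + r\<^sup>2)\<^sup>2 - r * (4 * (1 - r\<^sup>2)) = (1 - r\<^sup>2 - 2 * r)\<^sup>2"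
      by (simp add: power2_eq_square algebra_simps)
    ultimately show ?thesis
      unfolding r_def[symmetric] by (metis diff_ge_0_iff_ge zero_le_power2)
  qed
qed

section \<open>Subordination and membership in \<open>G\<close>\<close>

text \<open>Logarithmic differentiation of p = z f'/f without logarithms: on the punctured disk f' =
  p f / w, and the quotient rule gives f''. The relation is asked for only away from 0, where
  \<open>starlike_quotient\<close> is the plain quotient.\<close>

lemma convexity_quotient_eq:
  assumes f: "f \<in> \<A>" and z: "z \<in> \<D>" "z \<noteq> 0"
    and p: "\<And>w. w \<in> \<D> \<Longrightarrow> w \<noteq> 0 \<Longrightarrow> w * deriv f w / f w = p w \<and> f w \<noteq> 0"
    and dp: "(p has_field_derivative p') (at z)"
    and pz: "p z \<noteq> 0"
  shows "1 + z * deriv (deriv f) z / deriv f z = p z + z * p' / p z"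
proof -
  have df: "(f has_field_derivative deriv f z) (at z)"
    using f z holomorphic_derivI[OF _ open_ball] by (auto simp: class_A_def)
  have d: "((\<lambda>w. p w * f w / w) has_field_derivative
      ((p' * f z + p z * deriv f z) * z - p z * f z) / (z * z)) (at z)"
    using z by (auto intro!: derivative_eq_intros dp df)
  have ev: "p w * f w / w = deriv f w" if "w \<in> \<D> - {0}" for w
  proof -
    have "w * deriv f w / f w = p w" "f w \<noteq> 0" "w \<noteq> 0" using that p[of w] by auto
    then show ?thesis by (auto simp: field_simps)
  qed
  have "(deriv f has_field_derivative
      ((p' * f z + p z * deriv f z) * z - p z * f z) / (z * z)) (at z)"
    by (rule has_field_derivative_transform_within_open[OF d _ _ ev, of "\<D> - {0}"]) (use z in auto)
  then have *: "deriv (deriv f) z = ((p' * f z + p z * deriv f z) * z - p z * f z) / (z * z)"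
    by (rule DERIV_imp_deriv)
  have d1: "deriv f z = p z * f z / z" using ev[of z] z by simp
  show ?thesis
    unfolding * using z p[OF z] pz by (simp add: d1 divide_simps) (simp add: algebra_simps)
qed

text \<open>Reduces all three classes to one real inequality: \<open>B \<rho>\<close> majorises
  |\<phi>'/\<phi>^2| on |w| \<le> \<rho>, and \<open>less\<close> says, cleared of denominators,
  that \<open>B \<rho>\<close> times the bound on |z \<omega>'| is below 1.\<close>

lemma S_star_imp_G_disk:
  assumes f: "f \<in> S_star \<phi>"
    and d\<phi>: "\<And>w. w \<in> \<D> \<Longrightarrow> (\<phi> has_field_derivative \<phi>' w) (at w)"
    and \<phi>nz: "\<And>w. w \<in> \<D> \<Longrightarrow> \<phi> w \<noteq> 0" and \<phi>0: "\<phi> 0 = 1"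
    and r: "r \<le> 1"
    and B: "\<And>w \<rho>. \<rho> < 1 \<Longrightarrow> norm w \<le> \<rho> \<Longrightarrow> norm (\<phi>' w / (\<phi> w)\<^sup>2) \<le> B \<rho>"
    and less: "\<And>\<rho>. 0 < \<rho> \<Longrightarrow> \<rho> < r \<Longrightarrow> B \<rho> * (1 + \<rho>\<^sup>2)\<^sup>2 < 4 * (1 - \<rho>\<^sup>2)"
  shows "f \<in> G_disk (1/2) (1/2) r"
proof -
  from f obtain \<omega> where fA: "f \<in> \<A>" and fnz: "\<And>z. z \<in> \<D> - {0} \<Longrightarrow> f z \<noteq> 0"
    and \<omega>: "\<omega> holomorphic_on \<D>" "\<omega> ` \<D> \<subseteq> \<D>" "\<omega> 0 = 0"
    and q: "\<And>z. z \<in> \<D> \<Longrightarrow> starlike_quotient f z = \<phi> (\<omega> z)"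
    unfolding S_star_def subordinate_def by blast
  have \<omega>1: "norm (\<omega> z) < 1" if "norm z < 1" for z
    using \<omega>(2) that by (auto simp: image_subset_iff)
  have key: "(z \<noteq> 0 \<longrightarrow> f z \<noteq> 0) \<and> deriv f z \<noteq> 0 \<and>
     norm ((1 - of_real (1/2) + of_real (1/2) * (z * deriv (deriv f) z / deriv f z))
       / starlike_quotient f z - (1 - of_real (1/2))) < (1/2 :: real)" if zr: "norm z < r" for z
  proof (cases "z = 0")
    \<comment> \<open>At 0 subordination fixes the limiting value of the quotient as \<phi> 0 = 1,
      so no limit is computed and the expression is 1/2 - 1/2 = 0.\<close>
    case True
    then show ?thesis using fA q[of 0] \<omega> \<phi>0 by (simp add: class_A_def)
  next
    case False
    have z1: "norm z < 1" and zD: "z \<in> \<D>" using zr r by auto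
    have wD: "\<omega> z \<in> \<D>" using \<omega>1[OF z1] by simp
    have fz: "f z \<noteq> 0" using fnz zD False by blast
    have quot: "w * deriv f w / f w = \<phi> (\<omega> w) \<and> f w \<noteq> 0" if "w \<in> \<D>" "w \<noteq> 0" for w
      using q[of w] fnz[of w] that by (simp add: starlike_quotient_def)
    define p where "p = \<phi> (\<omega> z)"
    define p' where "p' = \<phi>' (\<omega> z) * deriv \<omega> z"
    have p0: "p \<noteq> 0" using \<phi>nz wD by (simp add: p_def)
    have dp: "((\<lambda>w. \<phi> (\<omega> w)) has_field_derivative p') (at z)"
      unfolding p'_def
      by (rule DERIV_chain2[OF d\<phi>[OF wD] holomorphic_derivI[OF \<omega>(1) open_ball zD]])
    have main: "1 + z * deriv (deriv f) z / deriv f z = p + z * p' / p"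
      using convexity_quotient_eq[OF fA zD False quot dp] p0 by (simp add: p_def)
    have "deriv f z \<noteq> 0" using quot[OF zD False] p0 by (auto simp: p_def)
    \<comment> \<open>Dividing (p + z p'/p) / 2 by p leaves 1/2 + z p' / (2 p^2), and this 1/2 is
      exactly the subtracted 1 - \<alpha>.\<close>
    moreover have "(1 - of_real (1/2) + of_real (1/2) * (z * deriv (deriv f) z / deriv f z))
        / starlike_quotient f z - (1 - of_real (1/2)) = z * p' / p\<^sup>2 / 2"
    proof -
      have "1 - of_real (1/2) + of_real (1/2) * (z * deriv (deriv f) z / deriv f z)
          = (1 + z * deriv (deriv f) z / deriv f z) / 2"
        by (simp add: field_simps)
      also have "\<dots> = (p + z * p' / p) / 2" by (simp only: main)
      finally have "1 - of_real (1/2) + of_real (1/2) * (z * deriv (deriv f) z / deriv f z)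
          = (p + z * p' / p) / 2" .
      moreover have "(p + z * p' / p) / 2 / p - 1 / 2 = z * p' / p\<^sup>2 / 2"
        using p0 by (simp add: divide_simps power2_eq_square)
      moreover have "1 - of_real (1/2) = (1/2 :: complex)" by simp
      ultimately show ?thesis using q[OF zD] by (simp only: p_def[symmetric])
    qed
    moreover have "norm (z * p' / p\<^sup>2) < 1"
    proof -
      define \<rho> where "\<rho> = norm z"
      have \<rho>: "0 < \<rho>" "\<rho> < r" "\<rho> < 1" using False zr z1 by (auto simp: \<rho>_def)
      then have \<rho>2: "\<rho>\<^sup>2 < 1" by (simp add: abs_square_less_1)
      \<comment> \<open>Schwarz's lemma gives |\<omega> z| \<le> \<rho>, so \<open>B\<close> applies
        at the point \<omega> z.\<close>
      have "norm (\<phi>' (\<omega> z) / p\<^sup>2) \<le> B \<rho>"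
        using B[OF \<rho>(3)] Schwarz_Lemma(1)[OF \<omega>(1,3) \<omega>1 z1] by (simp add: p_def \<rho>_def)
      moreover have "norm (z * deriv \<omega> z) * (4 * (1 - \<rho>\<^sup>2)) \<le> (1 + \<rho>\<^sup>2)\<^sup>2"
        using Dieudonne_bound[OF \<omega>(1,3) \<omega>1 z1] by (simp add: \<rho>_def)
      ultimately have "norm (\<phi>' (\<omega> z) / p\<^sup>2) * (norm (z * deriv \<omega> z) * (4 * (1 - \<rho>\<^sup>2)))
          \<le> B \<rho> * (1 + \<rho>\<^sup>2)\<^sup>2"
        using \<rho>2 by (intro mult_mono) (auto intro: order_trans[OF norm_ge_zero])
      also have "\<dots> < 4 * (1 - \<rho>\<^sup>2)" using less \<rho> by simp
      finally have "norm (\<phi>' (\<omega> z) / p\<^sup>2) * norm (z * deriv \<omega> z) * (4 * (1 - \<rho>\<^sup>2))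
          < 1 * (4 * (1 - \<rho>\<^sup>2))" by simp
      then have "norm (\<phi>' (\<omega> z) / p\<^sup>2) * norm (z * deriv \<omega> z) < 1"
        using \<rho>2 by (subst (asm) mult_less_cancel_right_pos) auto
      then show ?thesis by (simp add: p'_def norm_mult norm_divide mult_ac)
    qed
    ultimately show ?thesis using fz by (simp add: norm_divide)
  qed
  show ?thesis unfolding G_disk_def using fA key by blast
qed

section \<open>Locating the roots\<close>

text \<open>The intermediate value theorem supplies the root. Monotonicity is required from 0 on,
  not just on the bracket, so that no smaller positive root exists and \<open>F\<close> is negative
  all the way up to \<open>r\<close>; that sign feeds the membership lemmas.\<close>

lemma smallest_positive_root_between:
  fixes F :: "real \<Rightarrow> real"
  assumes ab: "0 < a" "a < b" and F: "F a < 0" "0 < F b"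
    and cont: "continuous_on {a..b} F" and mono: "strict_mono_on {0..b} F"
  obtains r where "a < r" "r < b" "smallest_positive_root F r" "\<And>s. 0 < s \<Longrightarrow> s < r \<Longrightarrow> F s < 0"
proof -
  obtain r where r: "a \<le> r" "r \<le> b" "F r = 0"
    using IVT'[of F a 0 b] F ab cont by auto
  then have "a < r" "r < b" using F by (auto simp: less_le)
  moreover have neg: "F s < 0" if "0 < s" "s < r" for s
    using strict_mono_onD[OF mono, of s r] that r by auto
  moreover have "smallest_positive_root F r"
    unfolding smallest_positive_root_def using neg ab r by fastforce
  ultimately show ?thesis using that by blast
qed

text \<open>The Lagrange remainder is nonnegative and, since exp 1 \<le> 3, at most 3 x^n / n!. This
  gives rational enclosures of \<open>exp\<close> at the bracket ends.\<close>

lemma exp_Taylor_bounds: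
  fixes x :: real
  assumes "0 \<le> x" "x \<le> 1"
  shows "(\<Sum>m<n. x ^ m / fact m) \<le> exp x"
    and "exp x \<le> (\<Sum>m<n. x ^ m / fact m) + 3 / fact n * x ^ n"
proof -
  obtain t where t: "\<bar>t\<bar> \<le> \<bar>x\<bar>" "exp x = (\<Sum>m<n. x ^ m / fact m) + exp t / fact n * x ^ n"
    using Maclaurin_exp_le by blast
  have "exp t \<le> exp 1" using t assms by simp
  then have "exp t \<le> 3" using exp_le by linarith
  then have "exp t / fact n * x ^ n \<le> 3 / fact n * x ^ n"
    using assms by (intro mult_right_mono divide_right_mono) auto
  then show "exp x \<le> (\<Sum>m<n. x ^ m / fact m) + 3 / fact n * x ^ n" using t by simp
  show "(\<Sum>m<n. x ^ m / fact m) \<le> exp x" using t assms by simp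
qed

lemma strict_mono_on_exp_root_equation:
  fixes c :: real
  assumes "c \<ge> 0"
  shows "strict_mono_on {0..b} (\<lambda>r. exp r * (1 + r\<^sup>2)\<^sup>2 - c * (1 - r\<^sup>2))"
proof (rule strict_mono_onI)
  fix r s :: real assume "r \<in> {0..b}" "s \<in> {0..b}" "r < s"
  then have "r\<^sup>2 < s\<^sup>2" "exp r < exp s" by (auto intro: power_strict_mono)
  moreover from this have "(1 + r\<^sup>2)\<^sup>2 < (1 + s\<^sup>2)\<^sup>2" by (intro power_strict_mono) auto
  ultimately have "exp r * (1 + r\<^sup>2)\<^sup>2 < exp s * (1 + s\<^sup>2)\<^sup>2" "c * r\<^sup>2 \<le> c * s\<^sup>2"
    using assms by (auto intro!: mult_strict_mono mult_left_mono)
  then show "exp r * (1 + r\<^sup>2)\<^sup>2 - c * (1 - r\<^sup>2) < exp s * (1 + s\<^sup>2)\<^sup>2 - c * (1 - s\<^sup>2)"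
    by (simp add: algebra_simps)
qed

text \<open>With b < 1 both factors of the subtracted product stay nonnegative, so their product
  decreases along with them.\<close>

lemma strict_mono_on_sqrt_root_equation:
  assumes "b < 1"
  shows "strict_mono_on {0..b} (\<lambda>r::real. (1 + r\<^sup>2)\<^sup>2 - 4 * (1 - r) powr (3/2) * (1 - r\<^sup>2))"
proof (rule strict_mono_onI)
  fix r s :: real assume rs: "r \<in> {0..b}" "s \<in> {0..b}" "r < s"
  then have "r\<^sup>2 < s\<^sup>2" by (auto intro: power_strict_mono)
  moreover from this have "(1 + r\<^sup>2)\<^sup>2 < (1 + s\<^sup>2)\<^sup>2" by (intro power_strict_mono) auto
  moreover have "s\<^sup>2 < 1" using rs assms by (auto simp: abs_square_less_1)
  moreover have "(1 - s) powr (3/2) \<le> (1 - r) powr (3/2)"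
    using rs assms by (intro powr_mono2) auto
  ultimately have "(1 + r\<^sup>2)\<^sup>2 < (1 + s\<^sup>2)\<^sup>2"
      "(1 - s) powr (3/2) * (1 - s\<^sup>2) \<le> (1 - r) powr (3/2) * (1 - r\<^sup>2)"
    by (auto intro!: mult_mono)
  then show "(1 + r\<^sup>2)\<^sup>2 - 4 * (1 - r) powr (3/2) * (1 - r\<^sup>2)
      < (1 + s\<^sup>2)\<^sup>2 - 4 * (1 - s) powr (3/2) * (1 - s\<^sup>2)"
    by simp
qed

lemma powr_three_halves:
  fixes x :: real
  assumes "0 \<le> x"
  shows "x powr (3/2) = x * sqrt x"
proof -
  have "x powr (3/2) = x powr (1 + 1/2)" by simp
  also have "\<dots> = x * sqrt x" using assms by (simp only: powr_add powr_half_sqrt) simp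
  finally show ?thesis .
qed

text \<open>The bracket is 0.537561 plus or minus half a unit of the sixth decimal.\<close>

lemma root_exp:
  obtains r where "0.5375605 < r" "r < 0.5375615"
    "smallest_positive_root (\<lambda>r. exp r * (1 + r\<^sup>2)\<^sup>2 - 4 * (1 - r\<^sup>2)) r"
    "\<And>s. 0 < s \<Longrightarrow> s < r \<Longrightarrow> exp s * (1 + s\<^sup>2)\<^sup>2 - 4 * (1 - s\<^sup>2) < 0"
proof (rule smallest_positive_root_between[where a = "0.5375605" and b = "0.5375615"
      and F = "\<lambda>r. exp r * (1 + r\<^sup>2)\<^sup>2 - 4 * (1 - r\<^sup>2)"])
  show "exp 0.5375605 * (1 + 0.5375605\<^sup>2)\<^sup>2 - 4 * (1 - 0.5375605\<^sup>2) < (0 :: real)"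
  proof -
    \<comment> \<open>The function changes by only about 1e-5 over the bracket, so
      \<open>exp\<close> must be known closely; ten Taylor terms leave an error below 2e-9.\<close>
    have "exp 0.5375605 \<le> (1.711826 :: real)"
      by (rule order_trans[OF exp_Taylor_bounds(2)[where n = 10]])
        (simp_all add: numeral_eq_Suc divide_simps)
    then have "exp 0.5375605 * (1 + 0.5375605\<^sup>2)\<^sup>2 \<le> 1.711826 * (1 + 0.5375605\<^sup>2 :: real)\<^sup>2"
      by (rule mult_right_mono) simp
    then show ?thesis by (simp add: power2_eq_square)
  qed
  show "(0 :: real) < exp 0.5375615 * (1 + 0.5375615\<^sup>2)\<^sup>2 - 4 * (1 - 0.5375615\<^sup>2)"
  proof -
    have "1.711827 \<le> exp (0.5375615 :: real)"
      by (rule order_trans[OF _ exp_Taylor_bounds(1)[where n = 10]])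
        (simp_all add: numeral_eq_Suc divide_simps)
    then have "1.711827 * (1 + 0.5375615\<^sup>2 :: real)\<^sup>2 \<le> exp 0.5375615 * (1 + 0.5375615\<^sup>2)\<^sup>2"
      by (rule mult_right_mono) simp
    then show ?thesis by (simp add: power2_eq_square)
  qed
  show "strict_mono_on {0..0.5375615} (\<lambda>r::real. exp r * (1 + r\<^sup>2)\<^sup>2 - 4 * (1 - r\<^sup>2))"
    by (rule strict_mono_on_exp_root_equation) simp
qed (auto intro!: continuous_intros intro: that)

lemma root_sigmoid:
  obtains r where "0.6834465 < r" "r < 0.6834475"
    "smallest_positive_root (\<lambda>r. exp r * (1 + r\<^sup>2)\<^sup>2 - 8 * (1 - r\<^sup>2)) r"
    "\<And>s. 0 < s \<Longrightarrow> s < r \<Longrightarrow> exp s * (1 + s\<^sup>2)\<^sup>2 - 8 * (1 - s\<^sup>2) < 0"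
proof (rule smallest_positive_root_between[where a = "0.6834465" and b = "0.6834475"
      and F = "\<lambda>r. exp r * (1 + r\<^sup>2)\<^sup>2 - 8 * (1 - r\<^sup>2)"])
  show "exp 0.6834465 * (1 + 0.6834465\<^sup>2)\<^sup>2 - 8 * (1 - 0.6834465\<^sup>2) < (0 :: real)"
  proof -
    have "exp 0.6834465 \<le> (1.980693 :: real)"
      by (rule order_trans[OF exp_Taylor_bounds(2)[where n = 10]])
        (simp_all add: numeral_eq_Suc divide_simps)
    then have "exp 0.6834465 * (1 + 0.6834465\<^sup>2)\<^sup>2 \<le> 1.980693 * (1 + 0.6834465\<^sup>2 :: real)\<^sup>2"
      by (rule mult_right_mono) simp
    then show ?thesis by (simp add: power2_eq_square)
  qed
  show "(0 :: real) < exp 0.6834475 * (1 + 0.6834475\<^sup>2)\<^sup>2 - 8 * (1 - 0.6834475\<^sup>2)"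
  proof -
    have "1.980694 \<le> exp (0.6834475 :: real)"
      by (rule order_trans[OF _ exp_Taylor_bounds(1)[where n = 10]])
        (simp_all add: numeral_eq_Suc divide_simps)
    then have "1.980694 * (1 + 0.6834475\<^sup>2 :: real)\<^sup>2 \<le> exp 0.6834475 * (1 + 0.6834475\<^sup>2)\<^sup>2"
      by (rule mult_right_mono) simp
    then show ?thesis by (simp add: power2_eq_square)
  qed
  show "strict_mono_on {0..0.6834475} (\<lambda>r::real. exp r * (1 + r\<^sup>2)\<^sup>2 - 8 * (1 - r\<^sup>2))"
    by (rule strict_mono_on_exp_root_equation) simp
qed (auto intro!: continuous_intros intro: that)

lemma root_sqrt:
  obtains r where "0.4298735 < r" "r < 0.4298745"
    "smallest_positive_root (\<lambda>r. (1 + r\<^sup>2)\<^sup>2 - 4 * (1 - r) powr (3/2) * (1 - r\<^sup>2)) r"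
    "\<And>s. 0 < s \<Longrightarrow> s < r \<Longrightarrow> (1 + s\<^sup>2)\<^sup>2 - 4 * (1 - s) powr (3/2) * (1 - s\<^sup>2) < 0"
proof (rule smallest_positive_root_between[where a = "0.4298735" and b = "0.4298745"
      and F = "\<lambda>r. (1 + r\<^sup>2)\<^sup>2 - 4 * (1 - r) powr (3/2) * (1 - r\<^sup>2)"])
  show "(1 + 0.4298735\<^sup>2)\<^sup>2 - 4 * (1 - 0.4298735) powr (3/2) * (1 - 0.4298735\<^sup>2) < (0 :: real)"
  proof -
    \<comment> \<open>0.7550666 lies between the square roots for the two bracket ends, so it serves
      as lower bound here and as upper bound at the other end.\<close>
    have "0.7550666 \<le> sqrt (1 - 0.4298735)"
      by (rule real_le_rsqrt) (simp add: power2_eq_square)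
    then show ?thesis by (simp add: powr_three_halves power2_eq_square)
  qed
  show "(0 :: real) < (1 + 0.4298745\<^sup>2)\<^sup>2 - 4 * (1 - 0.4298745) powr (3/2) * (1 - 0.4298745\<^sup>2)"
  proof -
    have "sqrt (1 - 0.4298745) \<le> 0.7550666"
      by (rule real_le_lsqrt) (simp_all add: power2_eq_square)
    then show ?thesis by (simp add: powr_three_halves power2_eq_square)
  qed
  show "strict_mono_on {0..0.4298745} (\<lambda>r::real. (1 + r\<^sup>2)\<^sup>2 - 4 * (1 - r) powr (3/2) * (1 - r\<^sup>2))"
    by (rule strict_mono_on_sqrt_root_equation) simp
qed (auto intro!: continuous_intros intro: that)

section \<open>The three classes\<close>

lemma norm_exp_minus_le:
  fixes w :: complex
  assumes "norm w \<le> \<rho>"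
  shows "norm (exp (- w)) \<le> exp \<rho>"
  using assms abs_Re_le_cmod[of w] by (simp add: norm_exp_eq_Re)

text \<open>Here \<phi>'/\<phi>^2 = exp (-w), and with B = \<open>exp\<close> the required
  inequality is the negativity of the root function itself.\<close>

lemma S_star_exp_imp_G_disk:
  assumes f: "f \<in> S_star (\<lambda>z. exp z)" and r: "r \<le> 1"
    and neg: "\<And>s. 0 < s \<Longrightarrow> s < r \<Longrightarrow> exp s * (1 + s\<^sup>2)\<^sup>2 - 4 * (1 - s\<^sup>2) < 0"
  shows "f \<in> G_disk (1/2) (1/2) r"
proof (rule S_star_imp_G_disk[OF f, where \<phi>' = exp and B = exp, OF _ _ _ r])
  fix w :: complex and \<rho> :: real assume "norm w \<le> \<rho>"
  moreover have "exp w / (exp w)\<^sup>2 = exp (- w)" by (simp add: exp_minus power2_eq_square field_simps)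
  ultimately show "norm (exp w / (exp w)\<^sup>2) \<le> exp \<rho>" using norm_exp_minus_le by simp
qed (use neg in \<open>auto intro: DERIV_exp\<close>)

text \<open>The square of 1 + exp (-w) cancels in \<phi>'/\<phi>^2, leaving exp (-w) / 2; the halved
  bound turns the 4 of the general inequality into 8.\<close>

lemma S_star_sigmoid_imp_G_disk:
  assumes f: "f \<in> S_star (\<lambda>z. 2 / (1 + exp (- z)))" and r: "r \<le> 1"
    and neg: "\<And>s. 0 < s \<Longrightarrow> s < r \<Longrightarrow> exp s * (1 + s\<^sup>2)\<^sup>2 - 8 * (1 - s\<^sup>2) < 0"
  shows "f \<in> G_disk (1/2) (1/2) r"
proof (rule S_star_imp_G_disk[OF f, where \<phi>' = "\<lambda>w. 2 * exp (- w) / (1 + exp (- w))\<^sup>2"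
      and B = "\<lambda>\<rho>. exp \<rho> / 2", OF _ _ _ r])
  \<comment> \<open>Since |Im w| < 1 < pi/2, the cosine of Im w is positive and 1 + exp (-w) has
    positive real part.\<close>
  have nz: "1 + exp (- w) \<noteq> 0" if "norm w < 1" for w :: complex
  proof -
    have "\<bar>Im w\<bar> < pi / 2" using abs_Im_le_cmod[of w] that pi_gt3 by linarith
    then have "0 < Re (1 + exp (- w))"
      by (auto simp: Re_exp abs_less_iff intro!: add_pos_pos mult_pos_pos cos_gt_zero_pi)
    then show ?thesis by (metis less_irrefl zero_complex.sel(1))
  qed
  show "((\<lambda>z. 2 / (1 + exp (- z))) has_field_derivative 2 * exp (- w) / (1 + exp (- w))\<^sup>2) (at w)"
    "2 / (1 + exp (- w)) \<noteq> 0" if "w \<in> \<D>" for w :: complex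
    using nz[of w] that
    by (auto intro!: derivative_eq_intros simp: power2_eq_square divide_simps)
  fix w :: complex and \<rho> :: real assume w: "\<rho> < 1" "norm w \<le> \<rho>"
  have "2 * exp (- w) / (1 + exp (- w))\<^sup>2 / (2 / (1 + exp (- w)))\<^sup>2 = exp (- w) / 2"
    using nz[of w] w by (simp add: power2_eq_square divide_simps)
  then show "norm (2 * exp (- w) / (1 + exp (- w))\<^sup>2 / (2 / (1 + exp (- w)))\<^sup>2) \<le> exp \<rho> / 2"
    using norm_exp_minus_le[OF w(2)] by (metis divide_right_mono norm_divide norm_numeral zero_le_numeral)
next
  fix \<rho> :: real assume "0 < \<rho>" "\<rho> < r"
  then show "exp \<rho> / 2 * (1 + \<rho>\<^sup>2)\<^sup>2 < 4 * (1 - \<rho>\<^sup>2)"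
    using neg[of \<rho>] by simp
qed simp

text \<open>Here |\<phi>'/\<phi>^2| = 1 / (2 |1 + w|^(3/2)) with |1 + w| \<ge> 1 - \<rho>.\<close>

lemma S_star_csqrt_imp_G_disk:
  assumes f: "f \<in> S_star (\<lambda>z. csqrt (1 + z))" and r: "r \<le> 1"
    and neg: "\<And>s. 0 < s \<Longrightarrow> s < r \<Longrightarrow> (1 + s\<^sup>2)\<^sup>2 - 4 * (1 - s) powr (3/2) * (1 - s\<^sup>2) < 0"
  shows "f \<in> G_disk (1/2) (1/2) r"
proof (rule S_star_imp_G_disk[OF f, where \<phi>' = "\<lambda>w. 1 / (2 * csqrt (1 + w))"
      and B = "\<lambda>\<rho>. 1 / (2 * (1 - \<rho>) powr (3/2))", OF _ _ _ r])
  \<comment> \<open>Keeps 1 + w off the branch cut of \<open>csqrt\<close>, where differentiability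
    would fail.\<close>
  have Re_pos: "0 < Re (1 + w)" if "norm w < 1" for w :: complex
    using abs_Re_le_cmod[of w] that by simp
  show "((\<lambda>z. csqrt (1 + z)) has_field_derivative 1 / (2 * csqrt (1 + w))) (at w)"
    "csqrt (1 + w) \<noteq> 0" if "w \<in> \<D>" for w :: complex
  proof -
    have "0 < Re (1 + w)" using Re_pos that by simp
    then have "1 + w \<notin> \<real>\<^sub>\<le>\<^sub>0" "1 + w \<noteq> 0"
      by (auto simp: complex_nonpos_Reals_iff simp del: plus_complex.simps)
    then show "((\<lambda>z. csqrt (1 + z)) has_field_derivative 1 / (2 * csqrt (1 + w))) (at w)"
        "csqrt (1 + w) \<noteq> 0"
      by (auto intro!: derivative_eq_intros)
  qed
  fix w :: complex and \<rho> :: real assume w: "\<rho> < 1" "norm w \<le> \<rho>"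
  have le: "1 - \<rho> \<le> norm (1 + w)"
    using w norm_triangle_ineq2[of 1 "- w"] by simp
  have "norm (1 / (2 * csqrt (1 + w)) / (csqrt (1 + w))\<^sup>2) = 1 / (2 * norm (1 + w) powr (3/2))"
    by (simp add: norm_divide norm_mult powr_three_halves norm_power mult_ac)
  also have "\<dots> \<le> 1 / (2 * (1 - \<rho>) powr (3/2))"
    using w le by (intro divide_left_mono mult_left_mono powr_mono2 mult_pos_pos) auto
  finally show "norm (1 / (2 * csqrt (1 + w)) / (csqrt (1 + w))\<^sup>2) \<le> 1 / (2 * (1 - \<rho>) powr (3/2))" .
next
  fix \<rho> :: real assume \<rho>: "0 < \<rho>" "\<rho> < r"
  define A where "A = (1 - \<rho>) powr (3/2)"
  have "0 < A" using \<rho> r by (simp add: A_def)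
  moreover have "\<rho>\<^sup>2 < 1" using \<rho> r by (simp add: abs_square_less_1)
  \<comment> \<open>The root equation gives the constant 4; positivity of
    \<open>A * (1 - \<rho>\<^sup>2)\<close> lets it be relaxed to the 8 that this \<open>B\<close>
    calls for.\<close>
  ultimately have "(1 + \<rho>\<^sup>2)\<^sup>2 < 8 * A * (1 - \<rho>\<^sup>2)"
    using neg[OF \<rho>] mult_pos_pos[of A "1 - \<rho>\<^sup>2"] unfolding A_def[symmetric] by linarith
  then show "1 / (2 * (1 - \<rho>) powr (3/2)) * (1 + \<rho>\<^sup>2)\<^sup>2 < 4 * (1 - \<rho>\<^sup>2)"
    using \<open>0 < A\<close> unfolding A_def[symmetric] by (simp add: field_simps)
qed simp


theorem theorem2p22:
  shows
    "(\<exists>r\<^sub>1. smallest_positive_root (\<lambda>r. exp r * (1 + r\<^sup>2)\<^sup>2 - 4 * (1 - r\<^sup>2)) r\<^sub>1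
        \<and> \<bar>r\<^sub>1 - 0.537561\<bar> \<le> 0.0000005
        \<and> (\<forall>f \<in> S_star (\<lambda>z. exp z). f \<in> G_disk (1/2) (1/2) r\<^sub>1))
   \<and> (\<exists>r\<^sub>2. smallest_positive_root (\<lambda>r. (1 + r\<^sup>2)\<^sup>2 - 4 * (1 - r) powr (3/2) * (1 - r\<^sup>2)) r\<^sub>2
        \<and> \<bar>r\<^sub>2 - 0.429874\<bar> \<le> 0.0000005
        \<and> (\<forall>f \<in> S_star (\<lambda>z. csqrt (1 + z)). f \<in> G_disk (1/2) (1/2) r\<^sub>2))
   \<and> (\<exists>r\<^sub>3. smallest_positive_root (\<lambda>r. exp r * (1 + r\<^sup>2)\<^sup>2 - 8 * (1 - r\<^sup>2)) r\<^sub>3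
        \<and> \<bar>r\<^sub>3 - 0.683447\<bar> \<le> 0.0000005
        \<and> (\<forall>f \<in> S_star (\<lambda>z. 2 / (1 + exp (- z))). f \<in> G_disk (1/2) (1/2) r\<^sub>3))"
proof (intro conjI)
  show "\<exists>r\<^sub>1. smallest_positive_root (\<lambda>r. exp r * (1 + r\<^sup>2)\<^sup>2 - 4 * (1 - r\<^sup>2)) r\<^sub>1
        \<and> \<bar>r\<^sub>1 - 0.537561\<bar> \<le> 0.0000005
        \<and> (\<forall>f \<in> S_star (\<lambda>z. exp z). f \<in> G_disk (1/2) (1/2) r\<^sub>1)"
  \<comment> \<open>The bracket gives both the decimal accuracy and r \<le> 1; the sign of the root
    function before its root is the premise \<open>neg\<close> of the membership lemma. The other
    two cases run alike.\<close>
  proof (rule root_exp, intro exI conjI ballI)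
    fix r :: real assume r: "0.5375605 < r" "r < 0.5375615"
    then show "\<bar>r - 0.537561\<bar> \<le> 0.0000005" by (simp add: abs_if)
  qed (auto intro: S_star_exp_imp_G_disk)
  show "\<exists>r\<^sub>2. smallest_positive_root (\<lambda>r. (1 + r\<^sup>2)\<^sup>2 - 4 * (1 - r) powr (3/2) * (1 - r\<^sup>2)) r\<^sub>2
        \<and> \<bar>r\<^sub>2 - 0.429874\<bar> \<le> 0.0000005
        \<and> (\<forall>f \<in> S_star (\<lambda>z. csqrt (1 + z)). f \<in> G_disk (1/2) (1/2) r\<^sub>2)"
  proof (rule root_sqrt, intro exI conjI ballI)
    fix r :: real assume r: "0.4298735 < r" "r < 0.4298745"
    then show "\<bar>r - 0.429874\<bar> \<le> 0.0000005" by (simp add: abs_if)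
  qed (auto intro: S_star_csqrt_imp_G_disk)
  show "\<exists>r\<^sub>3. smallest_positive_root (\<lambda>r. exp r * (1 + r\<^sup>2)\<^sup>2 - 8 * (1 - r\<^sup>2)) r\<^sub>3
        \<and> \<bar>r\<^sub>3 - 0.683447\<bar> \<le> 0.0000005
        \<and> (\<forall>f \<in> S_star (\<lambda>z. 2 / (1 + exp (- z))). f \<in> G_disk (1/2) (1/2) r\<^sub>3)"
  proof (rule root_sigmoid, intro exI conjI ballI)
    fix r :: real assume r: "0.6834465 < r" "r < 0.6834475"
    then show "\<bar>r - 0.683447\<bar> \<le> 0.0000005" by (simp add: abs_if)
  qed (auto intro: S_star_sigmoid_imp_G_disk)
qed

end
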